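(* Suppose $\mathcal{M}$ includes the rational type, i.e. $\{1,\dots,n\}\in\mathcal{M}$, and let $h$ be the interior equilibrium. Then for every $\theta\in\Theta$, $$2v^*-c-S^{\max}\le h(\theta)\le 2v^*-c-S^{\min}.$$ Moreover, the right-hand inequality holds with equality at the state $\theta$ with $S(\theta)=S^{\min}$.
   Context: Primitives: $\Theta=\Theta_1\times\cdots\times\Theta_n$ is a finite set of states; $\mu$ is a full-support probability distribution on $\Theta$; $S:\Theta\to(0,\infty)$ is one-to-one; $S^{\max}=\max_\theta S(\theta)$, $S^{\min}=\min_\theta S(\theta)$; $v^*,c$ are real numbers with $\Delta=v^*-c>0$; $\mathcal{M}$ is a finite nonempty collection of subsets of $\{1,\dots,n\}$ (consumers' cognitive types). For $M\subseteq\{1,\dots,n\}$ write $\theta_M=(\theta_i)_{i\in M}$, and let $\mu(\theta'\mid\theta'_M=\theta_M)$ be $\mu(\theta')/\sum_{\theta'':\theta''_M=\theta_M}\mu(\theta'')$ if $\theta'_M=\theta_M$, and $0$ otherwise. Firms have types $\pi\sim U[0,1]$; a type-$\pi$ firm is active at state $\theta$ and price $\phi$ iff $\phi-c+\pi S(\theta)\ge0$, and its add-on is $\pi S(\theta)$. Let $\pi^\star(\theta,\phi)=(c-\phi)/S(\theta)$ be the marginal type. For a price function $h:\Theta\to\mathbb{R}$, the expected add-on among active firms in state $\theta$ is $\bar q(\theta)=\frac{1+\pi^\star(\theta,h(\theta))}{2}S(\theta)$. Equilibrium (homogeneous-preference limit, in which all consumers' bare valuation is $v^*$ and equilibrium prices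 are taken to be fully revealing): $h:\Theta\to\mathbb{R}$ is an interior equilibrium if for every $\theta$, $\pi^\star(\theta,h(\theta))\in(0,1)$ and $$h(\theta)=v^*-\min_{M\in\mathcal{M}}\sum_{\theta'}\mu(\theta'\mid\theta'_M=\theta_M)\,\bar q(\theta').$$ *)

theory Defs
  imports "HOL-Probability.Probability"
begin

text \<open>
  A state is an extensional function on the attribute indices \<open>{1..n}\<close>, with \<open>T i\<close> the range of
  attribute \<open>i\<close>. A type \<open>M\<close> observes the components of the state with index in \<open>M\<close>, so two states
  look alike to \<open>M\<close> iff their restrictions to \<open>M\<close> coincide.
\<close>

definition state_space :: "nat \<Rightarrow> (nat \<Rightarrow> 'a set) \<Rightarrow> (nat \<Rightarrow> 'a) set" where
  "state_space n T = PiE {1..n} T"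

definition cond_prob ::
  "(nat \<Rightarrow> 'a) set \<Rightarrow> (nat \<Rightarrow> 'a) pmf \<Rightarrow> nat set \<Rightarrow> (nat \<Rightarrow> 'a) \<Rightarrow> (nat \<Rightarrow> 'a) \<Rightarrow> real" where
  "cond_prob \<Theta> \<mu> M \<theta> \<theta>' =
     (if restrict \<theta>' M = restrict \<theta> M
      then pmf \<mu> \<theta>' / (\<Sum>\<theta>''\<in>{\<theta>''\<in>\<Theta>. restrict \<theta>'' M = restrict \<theta> M}. pmf \<mu> \<theta>'')
      else 0)"

definition active :: "((nat \<Rightarrow> 'a) \<Rightarrow> real) \<Rightarrow> real \<Rightarrow> (nat \<Rightarrow> 'a) \<Rightarrow> real \<Rightarrow> real \<Rightarrow> bool" where
  "active S c \<theta> \<phi> \<pi> \<longleftrightarrow> \<phi> - c + \<pi> * S \<theta> \<ge> 0"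

definition marginal_type :: "((nat \<Rightarrow> 'a) \<Rightarrow> real) \<Rightarrow> real \<Rightarrow> (nat \<Rightarrow> 'a) \<Rightarrow> real \<Rightarrow> real" where
  "marginal_type S c \<theta> \<phi> = (c - \<phi>) / S \<theta>"

definition expected_addon ::
  "((nat \<Rightarrow> 'a) \<Rightarrow> real) \<Rightarrow> real \<Rightarrow> ((nat \<Rightarrow> 'a) \<Rightarrow> real) \<Rightarrow> (nat \<Rightarrow> 'a) \<Rightarrow> real" where
  "expected_addon S c h \<theta> = (1 + marginal_type S c \<theta> (h \<theta>)) / 2 * S \<theta>"

text \<open>
  For an interior marginal type, the closed form above is the mean add-on \<open>\<pi> * S \<theta>\<close> of a
  uniformly distributed firm type \<open>\<pi>\<close>, conditional on that type being active.
\<close>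

lemma active_iff:
  assumes "S \<theta> > 0"
  shows "active S c \<theta> \<phi> \<pi> \<longleftrightarrow> marginal_type S c \<theta> \<phi> \<le> \<pi>"
  using assms by (auto simp: active_def marginal_type_def field_simps)

lemma expected_addon_eq_conditional_mean:
  assumes S: "S \<theta> > 0" and int: "marginal_type S c \<theta> (h \<theta>) \<in> {0<..<1}"
  shows "expected_addon S c h \<theta> =
    (LINT \<pi>|uniform_measure lborel {\<pi>\<in>{0..1}. active S c \<theta> (h \<theta>) \<pi>}. \<pi> * S \<theta>)"
proof -
  define p where "p = marginal_type S c \<theta> (h \<theta>)"
  have p: "0 < p" "p < 1" using int by (auto simp: p_def)
  have A: "{\<pi>\<in>{0..1}. active S c \<theta> (h \<theta>) \<pi>} = {p..1}"
    using p by (auto simp: active_iff[where S = S and \<theta> = \<theta>, OF S] p_def)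
  have U: "uniform_measure lborel {p..1} =
      density lborel (\<lambda>x. ennreal (indicator {p..1} x / (1 - p)))"
    unfolding uniform_measure_def using p
    by (intro arg_cong2[where f = density] refl ext)
       (auto simp: indicator_def divide_ennreal[symmetric] simp del: divide_ennreal)
  have "(LINT x|uniform_measure lborel {p..1}. x * S \<theta>) =
      (LINT x|lborel. indicator {p..1} x / (1 - p) * (x * S \<theta>))"
    unfolding U using p by (subst integral_density) auto
  also have "\<dots> = (LINT x|lborel. (S \<theta> / (1 - p)) * (x ^ 1 * indicator {p..1} x))"
    by (rule arg_cong[where f = "integral\<^sup>L lborel"]) (simp add: fun_eq_iff mult_ac)
  also have "\<dots> = (S \<theta> / (1 - p)) * ((1 - p ^ 2) / 2)"
    using p by (subst integral_mult_right_zero, subst integral_power) (auto simp: numeral_2_eq_2)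
  also have "\<dots> = (1 + p) / 2 * S \<theta>"
    using p by (simp add: divide_simps) (simp add: power2_eq_square algebra_simps)
  finally show ?thesis
    unfolding A expected_addon_def p_def[symmetric] by (rule sym)
qed

definition interior_equilibrium ::
  "(nat \<Rightarrow> 'a) set \<Rightarrow> (nat \<Rightarrow> 'a) pmf \<Rightarrow> nat set set \<Rightarrow> ((nat \<Rightarrow> 'a) \<Rightarrow> real) \<Rightarrow> real \<Rightarrow> real
    \<Rightarrow> ((nat \<Rightarrow> 'a) \<Rightarrow> real) \<Rightarrow> bool" where
  "interior_equilibrium \<Theta> \<mu> \<M> S v c h \<longleftrightarrow>
     (\<forall>\<theta>\<in>\<Theta>. marginal_type S c \<theta> (h \<theta>) \<in> {0<..<1} \<and>
       h \<theta> = v - Min ((\<lambda>M. \<Sum>\<theta>'\<in>\<Theta>. cond_prob \<Theta> \<mu> M \<theta> \<theta>' * expected_addon S c h \<theta>') ` \<M>))"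

end

theory Submission
  imports Defs
begin

text \<open>
  The rational type gives the pointwise bound \<open>h \<theta> \<ge> 2 * v - c - S \<theta>\<close>, since the price is \<open>v\<close> minus a
  minimum over all types. At a state where \<open>h\<close> is maximal, every \<open>expected_addon\<close> is at least
  \<open>(Min (S ` \<Theta>) + c - h \<theta>) / 2\<close>, hence so is each conditional mean; solving the resulting inequality
  for \<open>h \<theta>\<close> gives the upper bound. At the state minimising \<open>S\<close> the two bounds coincide.
\<close>

lemma cond_prob_nonneg: "cond_prob \<Theta> \<mu> M \<theta> \<theta>' \<ge> 0"
  by (auto simp: cond_prob_def intro!: divide_nonneg_nonneg sum_nonneg)

lemma sum_cond_prob:
  assumes "finite \<Theta>" "\<theta> \<in> \<Theta>" "\<theta> \<in> set_pmf \<mu>"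
  shows "(\<Sum>\<theta>'\<in>\<Theta>. cond_prob \<Theta> \<mu> M \<theta> \<theta>') = 1"
proof -
  define C where "C = {\<theta>'\<in>\<Theta>. restrict \<theta>' M = restrict \<theta> M}"
  \<comment> \<open>The cell \<open>C\<close> contains \<open>\<theta>\<close>, which has positive
    mass; this keeps the denominator away from 0, where division would default to 0 and the weights
    would not sum to 1.\<close>
  have "sum (pmf \<mu>) C > 0"
    using assms by (intro sum_pos2[where i = \<theta>]) (auto simp: C_def pmf_positive)
  moreover have "(\<Sum>\<theta>'\<in>\<Theta>. cond_prob \<Theta> \<mu> M \<theta> \<theta>') = (\<Sum>\<theta>'\<in>C. pmf \<mu> \<theta>' / sum (pmf \<mu>) C)"
    unfolding C_def cond_prob_def by (rule sum.inter_filter[OF assms(1), symmetric])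
  ultimately show ?thesis
    by (simp flip: sum_divide_distrib)
qed

text \<open>The weights are nonnegative with total 1, so replacing every value by the constant
  \<open>a\<close> can only lower the mean.\<close>

lemma cond_mean_ge:
  assumes "finite \<Theta>" "\<theta> \<in> \<Theta>" "\<theta> \<in> set_pmf \<mu>" "\<And>\<theta>'. \<theta>' \<in> \<Theta> \<Longrightarrow> a \<le> q \<theta>'"
  shows "a \<le> (\<Sum>\<theta>'\<in>\<Theta>. cond_prob \<Theta> \<mu> M \<theta> \<theta>' * q \<theta>')"
proof -
  have "a = (\<Sum>\<theta>'\<in>\<Theta>. cond_prob \<Theta> \<mu> M \<theta> \<theta>' * a)"
    using sum_cond_prob[OF assms(1-3)] by (simp flip: sum_distrib_right)
  also have "\<dots> \<le> (\<Sum>\<theta>'\<in>\<Theta>. cond_prob \<Theta> \<mu> M \<theta> \<theta>' * q \<theta>')"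
    by (intro sum_mono mult_left_mono assms(4) cond_prob_nonneg)
  finally show ?thesis .
qed

text \<open>States are extensional on \<open>{1..n}\<close>, so restriction to \<open>{1..n}\<close>
  is the identity on them and the cell of \<open>\<theta>\<close> is a singleton.\<close>

lemma cond_mean_rational:
  assumes "\<Theta> = state_space n T" "finite \<Theta>" "\<theta> \<in> \<Theta>" "\<theta> \<in> set_pmf \<mu>"
  shows "(\<Sum>\<theta>'\<in>\<Theta>. cond_prob \<Theta> \<mu> {1..n} \<theta> \<theta>' * q \<theta>') = q \<theta>"
proof -
  have restr: "restrict \<theta>' {1..n} = \<theta>'" if "\<theta>' \<in> \<Theta>" for \<theta>'
    using that assms(1) by (auto simp: state_space_def)
  have off: "cond_prob \<Theta> \<mu> {1..n} \<theta> \<theta>' = 0" if "\<theta>' \<in> \<Theta> - {\<theta>}" for \<theta>'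
    using that restr[of \<theta>'] restr[OF assms(3)] by (auto simp: cond_prob_def)
  \<comment> \<open>Kept general in \<open>f\<close>: the constant 1 identifies the remaining weight
    as 1 by normalisation, and then \<open>q\<close> gives the claim.\<close>
  have "(\<Sum>\<theta>'\<in>\<Theta>. cond_prob \<Theta> \<mu> {1..n} \<theta> \<theta>' * f \<theta>') = cond_prob \<Theta> \<mu> {1..n} \<theta> \<theta> * f \<theta>"
    for f :: "_ \<Rightarrow> real"
    using assms(2,3) off by (simp add: sum.remove[of \<Theta> \<theta>] sum.neutral)
  from this[of "\<lambda>_. 1"] this[of q] show ?thesis
    using sum_cond_prob[OF assms(2-4)] by simp
qed

theorem proposition5:
  fixes n :: nat and T :: "nat \<Rightarrow> 'a set" and \<Theta> :: "(nat \<Rightarrow> 'a) set"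
    and \<mu> :: "(nat \<Rightarrow> 'a) pmf" and S h :: "(nat \<Rightarrow> 'a) \<Rightarrow> real"
    and v c :: real and \<M> :: "nat set set"
  assumes "\<Theta> = state_space n T"
    and "finite \<Theta>"
    and "set_pmf \<mu> = \<Theta>"
    and "\<forall>\<theta>\<in>\<Theta>. S \<theta> > 0"
    and "inj_on S \<Theta>"
    and "v - c > 0"
    and "\<M> \<subseteq> Pow {1..n}"
    and "\<M> \<noteq> {}"
    and "{1..n} \<in> \<M>"
    and "interior_equilibrium \<Theta> \<mu> \<M> S v c h"
  shows "(\<forall>\<theta>\<in>\<Theta>. 2 * v - c - Max (S ` \<Theta>) \<le> h \<theta> \<and> h \<theta> \<le> 2 * v - c - Min (S ` \<Theta>)) \<and>
         (\<forall>\<theta>\<in>\<Theta>. S \<theta> = Min (S ` \<Theta>) \<longrightarrow> h \<theta> = 2 * v - c - Min (S ` \<Theta>))"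
proof -
  note assms(2)[simp]
  let ?E = "\<lambda>\<theta> M. \<Sum>\<theta>'\<in>\<Theta>. cond_prob \<Theta> \<mu> M \<theta> \<theta>' * expected_addon S c h \<theta>'"
  have fin: "finite \<M>"
    using assms(7) by (rule finite_subset) simp
  have h: "h \<theta> = v - Min (?E \<theta> ` \<M>)" if "\<theta> \<in> \<Theta>" for \<theta>
    using assms(10) that by (auto simp: interior_equilibrium_def)
  \<comment> \<open>Since \<open>S \<theta>\<close> is positive it cancels, leaving a form that is
    linear in the price, increasing in \<open>S\<close> and decreasing in \<open>h\<close>.\<close>
  have q: "expected_addon S c h \<theta> = (S \<theta> + c - h \<theta>) / 2" if "\<theta> \<in> \<Theta>" for \<theta>
    using assms(4) that
    by (fastforce simp: expected_addon_def marginal_type_def field_simps)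
  have lower: "2 * v - c - S \<theta> \<le> h \<theta>" if "\<theta> \<in> \<Theta>" for \<theta>
  proof -
    have "Min (?E \<theta> ` \<M>) \<le> ?E \<theta> {1..n}"
      using fin assms(9) by (intro Min_le) auto
    also have "\<dots> = (S \<theta> + c - h \<theta>) / 2"
      using cond_mean_rational[OF assms(1) assms(2) that] that assms(3) q by simp
    finally show ?thesis
      using h[OF that] by simp
  qed
  have upper: "h \<theta> \<le> 2 * v - c - Min (S ` \<Theta>)" if \<theta>: "\<theta> \<in> \<Theta>" for \<theta>
  proof -
    have "Max (h ` \<Theta>) \<in> h ` \<Theta>"
      using \<theta> by (intro Max_in) auto
    then obtain \<theta>\<^sub>0 where \<theta>\<^sub>0: "\<theta>\<^sub>0 \<in> \<Theta>" "h \<theta>\<^sub>0 = Max (h ` \<Theta>)"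
      by auto
    have max: "h \<theta>' \<le> h \<theta>\<^sub>0" if "\<theta>' \<in> \<Theta>" for \<theta>'
      using that by (simp add: \<theta>\<^sub>0(2))
    \<comment> \<open>The minimum is attained by some type \<open>M\<close>; which one is
      irrelevant, because the bound below holds for every conditional mean.\<close>
    have "Min (?E \<theta>\<^sub>0 ` \<M>) \<in> ?E \<theta>\<^sub>0 ` \<M>"
      using fin assms(8) by (intro Min_in) auto
    then obtain M where M: "Min (?E \<theta>\<^sub>0 ` \<M>) = ?E \<theta>\<^sub>0 M"
      by auto
    \<comment> \<open>The monotonicity of the add-on in \<open>S\<close> and \<open>h\<close> allows
      both to be replaced by their extremes. The price at \<open>\<theta>\<^sub>0\<close> then
      enters both sides of the equilibrium equation, with coefficient 1/2 on the right, so it can be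
      solved for.\<close>
    have "(Min (S ` \<Theta>) + c - h \<theta>\<^sub>0) / 2 \<le> ?E \<theta>\<^sub>0 M"
    proof (rule cond_mean_ge)
      fix \<theta>' assume \<theta>': "\<theta>' \<in> \<Theta>"
      then have "Min (S ` \<Theta>) \<le> S \<theta>'"
        by (intro Min_le) auto
      then show "(Min (S ` \<Theta>) + c - h \<theta>\<^sub>0) / 2 \<le> expected_addon S c h \<theta>'"
        using q[OF \<theta>'] max[OF \<theta>'] by (simp add: field_simps)
    qed (use \<theta>\<^sub>0 assms(3) in auto)
    then show ?thesis
      using h[OF \<theta>\<^sub>0(1)] M max[OF \<theta>] by simp
  qed
  have "2 * v - c - Max (S ` \<Theta>) \<le> h \<theta>" if "\<theta> \<in> \<Theta>" for \<theta>
  proof -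
    have "S \<theta> \<le> Max (S ` \<Theta>)"
      using that by (intro Max_ge) auto
    then show ?thesis
      using lower[OF that] by linarith
  qed
  then show ?thesis
    using lower upper by (force intro: antisym)
qed

end
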